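(* Let $\mathfrak{g}$ be a Leibniz algebra such that $\gamma_2^{\mathsf{Lie}}(\mathfrak{g})$ is finite dimensional and $\frac{\mathfrak{g}}{Z_{\mathsf{Lie}}(\mathfrak{g})}$ is generated by $p$ elements. Then $$\dim\left(\mathsf{ID}_*^{\mathsf{Lie}}(\mathfrak{g})\right)\leq p\cdot\dim\left(\gamma_2^{\mathsf{Lie}}(\mathfrak{g})\right).$$
   Context: $\mathbb{K}$ is a fixed ground field with $\frac12\in\mathbb{K}$; dimensions are over $\mathbb{K}$. A Leibniz algebra over $\mathbb{K}$ is a $\mathbb{K}$-vector space $\mathfrak{g}$ with a bilinear bracket satisfying $[x,[y,z]]=[[x,y],z]-[[x,z],y]$ for all $x,y,z$. Put $[x,y]_{lie}=[x,y]+[y,x]$. The $\mathsf{Lie}$-center is the two-sided ideal $Z_{\mathsf{Lie}}(\mathfrak{g})=\{z\in\mathfrak{g}\mid [g,z]_{lie}=0\ \text{for all } g\in\mathfrak{g}\}$. $\gamma_2^{\mathsf{Lie}}(\mathfrak{g})=[\mathfrak{g},\mathfrak{g}]_{\mathsf{Lie}}$ is the two-sided ideal generated by all $[x,y]_{lie}$, $x,y\in\mathfrak{g}$. A $\mathsf{Lie}$-derivation of $\mathfrak{g}$ is a linear map $d:\mathfrak{g}\to\mathfrak{g}$ with $d([x,y]_{lie})=[d(x),y]_{lie}+[x,d(y)]_{lie}$ for all $x,y$. $\mathsf{ID}_*^{\mathsf{Lie}}(\mathfrak{g})$ is the set of $\mathsf{Lie}$-derivations $d$ with $d(\mathfrak{g})\subseteq\gamma_2^{\mathsf{Lie}}(\mathfrak{g})$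 that vanish on $Z_{\mathsf{Lie}}(\mathfrak{g})$; it is a Lie algebra under the commutator bracket.
   Formalization: "Generated by p elements" is taken to mean generated under the vector space operations and the induced bracket [x,y]_lie; if it means generated as a Leibniz algebra, the stated bound is false. *)

theory Defs
  imports Complex_Main "HOL-Library.Function_Algebras"
begin

locale leibniz_algebra = vector_space scale
  for scale :: "'k::field \<Rightarrow> 'a::ab_group_add \<Rightarrow> 'a" (infixr \<open>*s\<close> 75) +
  fixes bracket :: "'a \<Rightarrow> 'a \<Rightarrow> 'a" (\<open>\<lbrakk>_,/ _\<rbrakk>\<close>)
  assumes two_neq_zero: "(2::'k) \<noteq> 0"
    and bracket_add_left: "\<lbrakk>x + y, z\<rbrakk> = \<lbrakk>x, z\<rbrakk> + \<lbrakk>y, z\<rbrakk>"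
    and bracket_add_right: "\<lbrakk>x, y + z\<rbrakk> = \<lbrakk>x, y\<rbrakk> + \<lbrakk>x, z\<rbrakk>"
    and bracket_scale_left: "\<lbrakk>c *s x, y\<rbrakk> = c *s \<lbrakk>x, y\<rbrakk>"
    and bracket_scale_right: "\<lbrakk>x, c *s y\<rbrakk> = c *s \<lbrakk>x, y\<rbrakk>"
    and leibniz_identity: "\<lbrakk>x, \<lbrakk>y, z\<rbrakk>\<rbrakk> = \<lbrakk>\<lbrakk>x, y\<rbrakk>, z\<rbrakk> - \<lbrakk>\<lbrakk>x, z\<rbrakk>, y\<rbrakk>"
begin

definition lie_bracket :: "'a \<Rightarrow> 'a \<Rightarrow> 'a"
  where "lie_bracket x y = \<lbrakk>x, y\<rbrakk> + \<lbrakk>y, x\<rbrakk>"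

definition two_sided_ideal :: "'a set \<Rightarrow> bool"
  where "two_sided_ideal I \<longleftrightarrow> subspace I \<and> (\<forall>x\<in>I. \<forall>y. \<lbrakk>x, y\<rbrakk> \<in> I \<and> \<lbrakk>y, x\<rbrakk> \<in> I)"

definition lie_center :: "'a set"
  where "lie_center = {z. \<forall>x. lie_bracket x z = 0}"

definition gamma2 :: "'a set"
  where "gamma2 = two_sided_ideal hull {lie_bracket x y | x y. True}"

definition lie_derivation :: "('a \<Rightarrow> 'a) \<Rightarrow> bool"
  where "lie_derivation d \<longleftrightarrow> Vector_Spaces.linear scale scale d \<and>
    (\<forall>x y. d (lie_bracket x y) = lie_bracket (d x) y + lie_bracket x (d y))"

definition ID_star :: "('a \<Rightarrow> 'a) set"
  where "ID_star = {d. lie_derivation d \<and> range d \<subseteq> gamma2 \<and> (\<forall>z\<in>lie_center. d z = 0)}"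

text \<open>Pointwise scaling of maps; addition of maps comes from \<^theory>\<open>HOL-Library.Function_Algebras\<close>.\<close>

definition map_scale :: "'k \<Rightarrow> ('a \<Rightarrow> 'a) \<Rightarrow> ('a \<Rightarrow> 'a)"
  where "map_scale c f = (\<lambda>x. c *s f x)"

text \<open>The quotient by an ideal \<open>I\<close>, realised on the set of cosets. The summand from \<open>I\<close> in
  the operations below matters for \<open>0 *s A\<close> and for brackets, where the elementwise products
  alone need not fill a coset; the lemmas following the definitions show that the operations are
  the ones induced by representatives.\<close>

definition coset :: "'a set \<Rightarrow> 'a \<Rightarrow> 'a set"
  where "coset I x = {x + z | z. z \<in> I}"

definition quot :: "'a set \<Rightarrow> 'a set set"
  where "quot I = range (coset I)"

definition quot_add :: "'a set \<Rightarrow> 'a set \<Rightarrow> 'a set \<Rightarrow> 'a set"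
  where "quot_add I A B = {a + b + z | a b z. a \<in> A \<and> b \<in> B \<and> z \<in> I}"

definition quot_scale :: "'a set \<Rightarrow> 'k \<Rightarrow> 'a set \<Rightarrow> 'a set"
  where "quot_scale I c A = {c *s a + z | a z. a \<in> A \<and> z \<in> I}"

definition quot_bracket :: "'a set \<Rightarrow> 'a set \<Rightarrow> 'a set \<Rightarrow> 'a set"
  where "quot_bracket I A B = {\<lbrakk>a, b\<rbrakk> + z | a b z. a \<in> A \<and> b \<in> B \<and> z \<in> I}"

definition quot_lie_bracket :: "'a set \<Rightarrow> 'a set \<Rightarrow> 'a set \<Rightarrow> 'a set"
  where "quot_lie_bracket I A B = quot_add I (quot_bracket I A B) (quot_bracket I B A)"

text \<open>Generation is taken with respect to the vector space operations and the bracket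
  \<open>[x, y]\<^sub>l\<^sub>i\<^sub>e\<close>, the one respected by \<open>Lie\<close>-derivations. With the Leibniz bracket in
  its place the bound on the dimension of \<open>ID_star\<close> fails, since a \<open>Lie\<close>-derivation may vanish
  on \<open>x\<close> and \<open>y\<close> but not on their Leibniz bracket. For example, let \<open>A\<close> be the free unital
  associative algebra on three generators modulo degree 3 and \<open>G \<subseteq> A\<close> the Lie
  subalgebra generated by them. On \<open>A \<oplus> G\<close> put \<open>[m + x, n + y] = m y + (x y - y x)\<close>. Then
  the Leibniz subalgebra generated by \<open>1 \<in> A\<close> and the three generators in \<open>G\<close> is everything
  and \<open>gamma2\<close> has dimension 12, but every linear map from \<open>G\<close> to the degree 2 part
  of \<open>A\<close>, extended by 0 on \<open>A\<close>, is in \<open>ID_star\<close>, and \<open>6 * 9 > 4 * 12\<close>.\<close>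

definition quot_lie_subalgebra :: "'a set \<Rightarrow> 'a set set \<Rightarrow> bool"
  where "quot_lie_subalgebra I Q \<longleftrightarrow> Q \<subseteq> quot I \<and> I \<in> Q \<and>
    (\<forall>A\<in>Q. \<forall>B\<in>Q. quot_add I A B \<in> Q) \<and> (\<forall>c. \<forall>A\<in>Q. quot_scale I c A \<in> Q) \<and>
    (\<forall>A\<in>Q. \<forall>B\<in>Q. quot_lie_bracket I A B \<in> Q)"

text \<open>The \<open>p\<close> generators are a family, so they need not be distinct.\<close>

definition quot_lie_generated_by :: "'a set \<Rightarrow> nat \<Rightarrow> bool"
  where "quot_lie_generated_by I p \<longleftrightarrow>
    (\<exists>X. (\<forall>i<p. X i \<in> quot I) \<and> quot_lie_subalgebra I hull (X ` {..<p}) = quot I)"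

lemma bracket_zero [simp]: "\<lbrakk>0, x\<rbrakk> = 0" "\<lbrakk>x, 0\<rbrakk> = 0"
  using bracket_scale_left[of 0 x x] bracket_scale_right[of x 0 x] by simp_all

lemma bracket_minus_left: "\<lbrakk>- x, y\<rbrakk> = - \<lbrakk>x, y\<rbrakk>"
  using bracket_add_left[of x "- x" y] by (simp add: eq_neg_iff_add_eq_0 add.commute)

lemma bracket_minus_right: "\<lbrakk>x, - y\<rbrakk> = - \<lbrakk>x, y\<rbrakk>"
  using bracket_add_right[of x y "- y"] by (simp add: eq_neg_iff_add_eq_0 add.commute)

lemma two_sided_ideal_lie_center: "two_sided_ideal lie_center"
proof -
  have sub: "subspace lie_center"
    unfolding lie_center_def lie_bracket_def
    by (rule subspaceI)
      (auto simp: bracket_add_left bracket_add_right bracket_scale_left bracket_scale_right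
        scale_right_distrib[symmetric], metis add.assoc add.left_commute add_0)
  have right: "\<lbrakk>z, x\<rbrakk> \<in> lie_center" if z: "z \<in> lie_center" for z x
  proof -
    have neg: "\<lbrakk>z, y\<rbrakk> = - \<lbrakk>y, z\<rbrakk>" for y
      using z unfolding lie_center_def lie_bracket_def
      by (simp add: eq_neg_iff_add_eq_0 add.commute)
    have sq: "\<lbrakk>z, \<lbrakk>a, x\<rbrakk>\<rbrakk> + \<lbrakk>z, \<lbrakk>x, a\<rbrakk>\<rbrakk> = 0" for a
      by (simp add: leibniz_identity)
    have "\<lbrakk>a, \<lbrakk>z, x\<rbrakk>\<rbrakk> + \<lbrakk>\<lbrakk>z, x\<rbrakk>, a\<rbrakk> = 0" for a
    proof -
      have "\<lbrakk>a, \<lbrakk>z, x\<rbrakk>\<rbrakk> = \<lbrakk>\<lbrakk>a, z\<rbrakk>, x\<rbrakk> - \<lbrakk>\<lbrakk>a, x\<rbrakk>, z\<rbrakk>"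
        by (rule leibniz_identity)
      also have "\<lbrakk>\<lbrakk>a, z\<rbrakk>, x\<rbrakk> = - \<lbrakk>\<lbrakk>z, a\<rbrakk>, x\<rbrakk>"
        by (simp add: neg bracket_minus_left)
      also have "\<lbrakk>\<lbrakk>a, x\<rbrakk>, z\<rbrakk> = - \<lbrakk>z, \<lbrakk>a, x\<rbrakk>\<rbrakk>"
        by (simp add: neg)
      also have "\<lbrakk>z, \<lbrakk>a, x\<rbrakk>\<rbrakk> = \<lbrakk>\<lbrakk>z, a\<rbrakk>, x\<rbrakk> - \<lbrakk>\<lbrakk>z, x\<rbrakk>, a\<rbrakk>"
        by (rule leibniz_identity)
      finally show ?thesis by simp
    qed
    then show ?thesis by (simp add: lie_center_def lie_bracket_def)
  qed
  have left: "\<lbrakk>x, z\<rbrakk> \<in> lie_center" if z: "z \<in> lie_center" for z x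
  proof -
    have "\<lbrakk>x, z\<rbrakk> = - \<lbrakk>z, x\<rbrakk>"
      using z unfolding lie_center_def lie_bracket_def
      by (simp add: eq_neg_iff_add_eq_0)
    then show ?thesis using right[OF z, of x] subspace_neg[OF sub] by simp
  qed
  show ?thesis using sub right left by (simp add: two_sided_ideal_def)
qed

context
  fixes I assumes I: "two_sided_ideal I"
begin

lemma ideal_facts:
  "0 \<in> I" "a \<in> I \<Longrightarrow> b \<in> I \<Longrightarrow> a + b \<in> I" "a \<in> I \<Longrightarrow> c *s a \<in> I"
  "a \<in> I \<Longrightarrow> \<lbrakk>a, x\<rbrakk> \<in> I" "a \<in> I \<Longrightarrow> \<lbrakk>x, a\<rbrakk> \<in> I"
  using I by (auto simp: two_sided_ideal_def subspace_def)

lemma coset_zero: "coset I 0 = I"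
  by (auto simp: coset_def)

lemma quot_add_coset: "quot_add I (coset I x) (coset I y) = coset I (x + y)"
proof (intro equalityI subsetI)
  fix w assume "w \<in> quot_add I (coset I x) (coset I y)"
  then obtain a b z where "a \<in> I" "b \<in> I" "z \<in> I" "w = (x + a) + (y + b) + z"
    by (auto simp: quot_add_def coset_def)
  then have "w = (x + y) + (a + b + z)" "a + b + z \<in> I"
    by (auto simp: algebra_simps intro!: ideal_facts)
  then show "w \<in> coset I (x + y)" by (auto simp: coset_def)
next
  fix w assume "w \<in> coset I (x + y)"
  then obtain z where "z \<in> I" "w = x + y + z" by (auto simp: coset_def)
  moreover have "x \<in> coset I x" "y \<in> coset I y"
    using ideal_facts(1) by (force simp: coset_def)+
  ultimately show "w \<in> quot_add I (coset I x) (coset I y)"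
    unfolding quot_add_def by blast
qed

lemma quot_scale_coset: "quot_scale I c (coset I x) = coset I (c *s x)"
proof (intro equalityI subsetI)
  fix w assume "w \<in> quot_scale I c (coset I x)"
  then obtain a z where "a \<in> I" "z \<in> I" "w = c *s (x + a) + z"
    by (auto simp: quot_scale_def coset_def)
  then have "w = c *s x + (c *s a + z)" "c *s a + z \<in> I"
    by (auto simp: algebra_simps scale_right_distrib intro!: ideal_facts)
  then show "w \<in> coset I (c *s x)" by (auto simp: coset_def)
next
  fix w assume "w \<in> coset I (c *s x)"
  then obtain z where "z \<in> I" "w = c *s x + z" by (auto simp: coset_def)
  moreover have "x \<in> coset I x"
    using ideal_facts(1) by (force simp: coset_def)
  ultimately show "w \<in> quot_scale I c (coset I x)"
    unfolding quot_scale_def by blast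
qed

lemma quot_bracket_coset: "quot_bracket I (coset I x) (coset I y) = coset I \<lbrakk>x, y\<rbrakk>"
proof (intro equalityI subsetI)
  fix w assume "w \<in> quot_bracket I (coset I x) (coset I y)"
  then obtain a b z where "a \<in> I" "b \<in> I" "z \<in> I" "w = \<lbrakk>x + a, y + b\<rbrakk> + z"
    by (auto simp: quot_bracket_def coset_def)
  then have "w = \<lbrakk>x, y\<rbrakk> + (\<lbrakk>x, b\<rbrakk> + \<lbrakk>a, y\<rbrakk> + \<lbrakk>a, b\<rbrakk> + z)" "\<lbrakk>x, b\<rbrakk> + \<lbrakk>a, y\<rbrakk> + \<lbrakk>a, b\<rbrakk> + z \<in> I"
    by (simp_all add: algebra_simps bracket_add_left bracket_add_right ideal_facts)
  then show "w \<in> coset I \<lbrakk>x, y\<rbrakk>" by (auto simp: coset_def)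
next
  fix w assume "w \<in> coset I \<lbrakk>x, y\<rbrakk>"
  then obtain z where "z \<in> I" "w = \<lbrakk>x, y\<rbrakk> + z" by (auto simp: coset_def)
  moreover have "x \<in> coset I x" "y \<in> coset I y"
    using ideal_facts(1) by (force simp: coset_def)+
  ultimately show "w \<in> quot_bracket I (coset I x) (coset I y)"
    unfolding quot_bracket_def by blast
qed

lemma quot_lie_bracket_coset:
  "quot_lie_bracket I (coset I x) (coset I y) = coset I (lie_bracket x y)"
  by (simp add: quot_lie_bracket_def quot_bracket_coset quot_add_coset lie_bracket_def)

end

lemma vector_space_map_scale: "vector_space map_scale"
  by unfold_locales
    (auto simp: map_scale_def fun_eq_iff scale_right_distrib scale_left_distrib)

end

text \<open>For a family of vectors that is not contained in a finite-dimensional space,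
  \<^const>\<open>vector_space.dim\<close> need not be meaningful (it may default to 0), hence this explicit predicate.\<close>

definition finite_dim :: "('k::field \<Rightarrow> 'v::ab_group_add \<Rightarrow> 'v) \<Rightarrow> 'v set \<Rightarrow> bool"
  where "finite_dim s V \<longleftrightarrow> (\<exists>B. finite B \<and> V \<subseteq> module.span s B)"

end

theory Submission
  imports Defs
begin

text \<open>A map in \<open>ID_star\<close> that kills representatives of the \<open>p\<close> generators kills everything: the
  cosets on which a \<open>Lie\<close>-derivation vanishing on the \<open>Lie\<close>-center is zero are closed under the
  operations of the quotient. So evaluation at the representatives embeds \<open>ID_star\<close> linearly into
  \<open>p\<close> copies of \<open>gamma2\<close>.\<close>

text \<open>The image of a basis of \<open>V\<close> is independent and lies in
  \<open>span T\<close>, so the exchange lemma bounds it by \<open>card T\<close>. Finiteness of the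
  basis itself is pulled back along \<open>f\<close>, so \<open>dim\<close> is a genuine dimension
  here and not a default value.\<close>

lemma inj_linear_dim_le:
  assumes f: "Vector_Spaces.linear s1 s2 f"
    and V: "module.subspace s1 V" and inj: "inj_on f V"
    and T: "finite T" "f ` V \<subseteq> module.span s2 T"
  shows "finite_dim s1 V \<and> vector_space.dim s1 V \<le> card T"
proof -
  interpret f: Vector_Spaces.linear s1 s2 f by (rule f)
  obtain B where B: "B \<subseteq> V" "f.vs1.independent B" "V \<subseteq> f.vs1.span B" "card B = f.vs1.dim V"
    by (rule f.vs1.basis_exists)
  \<comment> \<open>Independence passes to the image only if \<open>f\<close> is injective on the
    whole span of \<open>B\<close>; this is where \<open>V\<close> has to be a subspace.\<close>
  have span: "f.vs1.span B \<subseteq> V"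
    by (rule f.vs1.span_minimal[OF B(1) V])
  have "f.vs2.independent (f ` B)"
    using B(2) inj span by (intro f.independent_injective_image) (auto intro: inj_on_subset)
  moreover have "f ` B \<subseteq> f.vs2.span T"
    using B(1) T(2) by blast
  ultimately have "finite (f ` B)" "card (f ` B) \<le> card T"
    using f.vs2.independent_span_bound[OF T(1)] by blast+
  moreover have "inj_on f B"
    using inj B(1) by (rule inj_on_subset)
  ultimately show ?thesis
    using B(3,4) by (auto simp: finite_dim_def card_image dest: finite_imageD)
qed

context vector_space
begin

lemma vector_space_pointwise: "vector_space (\<lambda>c f x. scale c (f x))"
  by unfold_locales (auto simp: fun_eq_iff scale_right_distrib scale_left_distrib)

text \<open>A family supported on a finite set is the sum of its one-entry parts, and each entry
  expands over \<open>B\<close>. The spanning set has at most \<open>card I * card B\<close>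
  elements, which is the source of the product in the final bound.\<close>

lemma pointwise_family_in_span:
  fixes g :: "'i \<Rightarrow> 'b"
  assumes I: "finite I" and g: "\<And>i. i \<in> I \<Longrightarrow> g i \<in> span B" "\<And>i. i \<notin> I \<Longrightarrow> g i = 0"
  shows "g \<in> module.span (\<lambda>c f x. scale c (f x)) ((\<lambda>(i, b) j. if j = i then b else 0) ` (I \<times> B))"
    (is "_ \<in> module.span _ ?T")
proof -
  interpret pw: vector_space "\<lambda>c (f :: 'i \<Rightarrow> 'b) x. scale c (f x)"
    by (rule vector_space_pointwise)
  have single: "(\<lambda>j. if j = i then v else 0) \<in> pw.span ?T" if "i \<in> I" "v \<in> span B" for i v
    using that(2)
  proof (induction rule: span_induct_alt)
    case base
    have "(\<lambda>j. if j = i then 0 else 0) = (0 :: 'i \<Rightarrow> 'b)" by auto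
    then show ?case using pw.span_zero[of ?T] by simp
  next
    case (step c b v)
    have "(\<lambda>j. if j = i then b else 0) \<in> ?T"
      using \<open>b \<in> B\<close> \<open>i \<in> I\<close> by force
    then have "(\<lambda>j. scale c (if j = i then b else 0)) + (\<lambda>j. if j = i then v else 0) \<in> pw.span ?T"
      by (intro pw.span_add step pw.span_scale pw.span_base)
    also have "(\<lambda>j. scale c (if j = i then b else 0)) + (\<lambda>j. if j = i then v else 0)
        = (\<lambda>j. if j = i then scale c b + v else 0)"
      by auto
    finally show ?case .
  qed
  have "g = (\<Sum>i\<in>I. (\<lambda>j. if j = i then g i else 0))"
  proof
    fix j
    have "(\<Sum>i\<in>I. (\<lambda>j. if j = i then g i else 0)) j = (\<Sum>i\<in>I. if j = i then g i else 0)"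
      using I by (induction rule: finite_induct) auto
    also have "\<dots> = g j" using I g(2) by simp
    finally show "g j = (\<Sum>i\<in>I. (\<lambda>j. if j = i then g i else 0)) j" by simp
  qed
  also have "\<dots> \<in> pw.span ?T"
    by (intro pw.span_sum single g(1))
  finally show ?thesis .
qed

text \<open>The finite spanning set given by \<open>finite_dim\<close> may lie outside
  \<open>V\<close> and be larger than \<open>dim V\<close>. It still forces a basis of
  \<open>V\<close> to be finite, and the basis has the right size.\<close>

lemma finite_dim_basis:
  assumes "finite_dim scale V"
  obtains B where "finite B" "V \<subseteq> span B" "card B = dim V"
proof -
  obtain B where B: "B \<subseteq> V" "independent B" "V \<subseteq> span B" "card B = dim V"
    by (rule basis_exists)
  obtain C where "finite C" "V \<subseteq> span C"
    using assms by (auto simp: finite_dim_def)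
  then have "finite B"
    using independent_span_bound[of C B] B(1,2) by blast
  with B(3,4) show thesis by (rule that[rotated 1])
qed

end

context leibniz_algebra
begin

lemma subspace_gamma2: "subspace gamma2"
  unfolding gamma2_def hull_def two_sided_ideal_def by (blast intro: subspace_Inter)

lemma lie_bracket_zero [simp]: "lie_bracket 0 x = 0" "lie_bracket x 0 = 0"
  by (simp_all add: lie_bracket_def)

lemma lie_bracket_add:
  "lie_bracket (x + y) z = lie_bracket x z + lie_bracket y z"
  "lie_bracket x (y + z) = lie_bracket x y + lie_bracket x z"
  by (simp_all add: lie_bracket_def bracket_add_left bracket_add_right algebra_simps)

lemma lie_bracket_scale:
  "lie_bracket (c *s x) y = c *s lie_bracket x y"
  "lie_bracket x (c *s y) = c *s lie_bracket x y"
  by (simp_all add: lie_bracket_def bracket_scale_left bracket_scale_right scale_right_distrib)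

lemma lie_derivation_simps:
  assumes "lie_derivation d"
  shows "d (x + y) = d x + d y" "d (c *s x) = c *s d x" "d 0 = 0"
    "d (lie_bracket x y) = lie_bracket (d x) y + lie_bracket x (d y)"
proof -
  interpret d: Vector_Spaces.linear scale scale d
    using assms by (simp add: lie_derivation_def)
  show "d (x + y) = d x + d y" "d (c *s x) = c *s d x" "d 0 = 0"
    by (simp_all add: d.add d.scale d.zero)
  show "d (lie_bracket x y) = lie_bracket (d x) y + lie_bracket x (d y)"
    using assms by (simp add: lie_derivation_def)
qed

lemma lie_derivationI:
  assumes "\<And>x y. d (x + y) = d x + d y" "\<And>c x. d (c *s x) = c *s d x"
    "\<And>x y. d (lie_bracket x y) = lie_bracket (d x) y + lie_bracket x (d y)"
  shows "lie_derivation d"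
  using assms vector_space_axioms
  by (simp add: lie_derivation_def Vector_Spaces.linear_iff)

lemma subspace_ID_star: "module.subspace map_scale ID_star"
proof -
  interpret ms: vector_space map_scale by (rule vector_space_map_scale)
  show ?thesis
  proof (rule ms.subspaceI)
    show "0 \<in> ID_star"
      using subspace_0[OF subspace_gamma2]
      by (auto simp: ID_star_def intro!: lie_derivationI)
  next
    fix d e assume "d \<in> ID_star" "e \<in> ID_star"
    then show "d + e \<in> ID_star"
      using subspace_add[OF subspace_gamma2]
      by (auto simp: ID_star_def lie_derivation_simps lie_bracket_add scale_right_distrib
          algebra_simps image_subset_iff intro!: lie_derivationI)
  next
    fix c d assume "d \<in> ID_star"
    then show "map_scale c d \<in> ID_star"
      using subspace_scale[OF subspace_gamma2]
      by (auto simp: ID_star_def map_scale_def lie_derivation_simps lie_bracket_scale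
          scale_right_distrib mult.commute image_subset_iff intro!: lie_derivationI)
  qed
qed

text \<open>If \<open>d\<close> kills \<open>x\<close> and \<open>y\<close>, both terms of the
  derivation rule for \<open>lie_bracket x y\<close> vanish. The rule says nothing about the Leibniz
  bracket, so closure holds for the symmetrized one. The coset \<open>I\<close> is represented by
  0.\<close>

lemma quot_lie_subalgebra_zeros:
  assumes d: "lie_derivation d" and I: "two_sided_ideal I" and dI: "\<And>z. z \<in> I \<Longrightarrow> d z = 0"
  shows "quot_lie_subalgebra I (coset I ` {x. d x = 0})"
proof -
  have "I \<in> coset I ` {x. d x = 0}"
    using coset_zero[OF I] by (force simp: lie_derivation_simps[OF d])
  then show ?thesis
    unfolding quot_lie_subalgebra_def
    by (auto simp: quot_def quot_add_coset[OF I] quot_scale_coset[OF I]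
        quot_lie_bracket_coset[OF I] lie_derivation_simps[OF d])
qed

lemma lie_derivation_eq_zeroI:
  assumes d: "lie_derivation d" and I: "two_sided_ideal I" and dI: "\<And>z. z \<in> I \<Longrightarrow> d z = 0"
    and gen: "quot_lie_subalgebra I hull (coset I ` S) = quot I"
    and S: "\<And>x. x \<in> S \<Longrightarrow> d x = 0"
  shows "d = 0"
proof
  fix y
  \<comment> \<open>This only says that every coset has some representative killed by
    \<open>d\<close>; the rest of the coset follows because \<open>d\<close> vanishes on
    \<open>I\<close>.\<close>
  have "quot I \<subseteq> coset I ` {x. d x = 0}"
    unfolding gen[symmetric]
    using S by (intro hull_minimal quot_lie_subalgebra_zeros[OF d I dI]) auto
  then obtain x where x: "d x = 0" "coset I y = coset I x"
    by (auto simp: quot_def)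
  have "y \<in> coset I y"
    using ideal_facts(1)[OF I] by (force simp: coset_def)
  then obtain z where "y = x + z" "z \<in> I"
    unfolding x(2) by (auto simp: coset_def)
  then show "d y = 0 y"
    by (simp add: lie_derivation_simps[OF d] x(1) dI)
qed

lemma ID_star_dim_le:
  assumes fin: "finite_dim scale gamma2" and gen: "quot_lie_generated_by lie_center p"
  shows "finite_dim map_scale ID_star \<and> vector_space.dim map_scale ID_star \<le> p * dim gamma2"
proof -
  interpret pw: vector_space "\<lambda>c (f :: nat \<Rightarrow> 'a) i. c *s f i" by (rule vector_space_pointwise)
  obtain B where B: "finite B" "gamma2 \<subseteq> span B" "card B = dim gamma2"
    using fin by (rule finite_dim_basis)
  obtain X where X: "\<And>i. i < p \<Longrightarrow> X i \<in> quot lie_center"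
      "quot_lie_subalgebra lie_center hull (X ` {..<p}) = quot lie_center"
    using gen by (auto simp: quot_lie_generated_by_def)
  \<comment> \<open>The bound on \<open>i\<close> sits under the existential so that choice yields a
    total function \<open>x\<close> of representatives.\<close>
  then have "\<forall>i. \<exists>x. i < p \<longrightarrow> X i = coset lie_center x"
    unfolding quot_def by (metis imageE)
  then obtain x where x: "\<And>i. i < p \<Longrightarrow> X i = coset lie_center (x i)"
    by metis
  have "X ` {..<p} = coset lie_center ` x ` {..<p}"
    unfolding image_image using x by (intro image_cong) auto
  with X(2) have gen_x:
    "quot_lie_subalgebra lie_center hull (coset lie_center ` x ` {..<p}) = quot lie_center"
    by simp
  \<comment> \<open>Evaluation at the representatives. The \<open>p\<close> copies of
    \<open>gamma2\<close> are modelled as families over all naturals, padded with 0 from index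
    \<open>p\<close> on, which keeps the image in a finite-dimensional space.\<close>
  define f where "f = (\<lambda>(d :: 'a \<Rightarrow> 'a) i. if i < p then d (x i) else 0)"
  have f_lin: "Vector_Spaces.linear map_scale (\<lambda>c f i. c *s f i) f"
    using vector_space_map_scale pw.vector_space_axioms
    by (auto simp: Vector_Spaces.linear_iff f_def map_scale_def fun_eq_iff)
  interpret f: Vector_Spaces.linear map_scale "\<lambda>c f i. c *s f i" f by (rule f_lin)
  have f_inj: "inj_on f ID_star"
    unfolding f.inj_on_iff_eq_0[OF subspace_ID_star]
  proof (intro ballI impI)
    fix d assume d: "d \<in> ID_star" and 0: "f d = 0"
    have "d (x i) = 0" if "i < p" for i
      using fun_cong[OF 0, of i] that by (simp add: f_def)
    with d show "d = 0"
      by (intro lie_derivation_eq_zeroI[OF _ two_sided_ideal_lie_center _ gen_x])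
        (auto simp: ID_star_def)
  qed
  let ?T = "(\<lambda>(i, b) j. if j = i then b else 0) ` ({..<p} \<times> B)"
  have f_img: "f ` ID_star \<subseteq> pw.span ?T"
  proof
    fix g assume "g \<in> f ` ID_star"
    then show "g \<in> pw.span ?T"
      using B(2) by (intro pointwise_family_in_span) (auto simp: f_def ID_star_def image_subset_iff)
  qed
  \<comment> \<open>An upper bound suffices, so distinct pairs \<open>(i, b)\<close> may give the
    same family, as they do when \<open>b\<close> is 0.\<close>
  have "card ?T \<le> p * dim gamma2"
    using card_image_le[of "{..<p} \<times> B"] B(1,3) by (simp add: card_cartesian_product)
  with inj_linear_dim_le[OF f_lin subspace_ID_star f_inj _ f_img] B(1)
  show ?thesis by fastforce
qed

end

theorem theorem5p9:
  fixes scale :: "'k::field \<Rightarrow> 'a::ab_group_add \<Rightarrow> 'a"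
    and bracket :: "'a \<Rightarrow> 'a \<Rightarrow> 'a"
    and p :: nat
  assumes "leibniz_algebra scale bracket"
    and "finite_dim scale (leibniz_algebra.gamma2 scale bracket)"
    and "leibniz_algebra.quot_lie_generated_by scale bracket
           (leibniz_algebra.lie_center bracket) p"
  shows "finite_dim (leibniz_algebra.map_scale scale) (leibniz_algebra.ID_star scale bracket)
    \<and> vector_space.dim (leibniz_algebra.map_scale scale) (leibniz_algebra.ID_star scale bracket)
      \<le> p * vector_space.dim scale (leibniz_algebra.gamma2 scale bracket)"
  using assms by (rule leibniz_algebra.ID_star_dim_le)

end
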